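(* Let $S\subset\mathbb{R}^d$ be a bounded polytope with set of extreme points $\{v^1,\dots,v^M\}$ and diameter $D=\sup_{x,y\in S}\|x-y\|$. Let $L>0$ and let $f:\mathbb{R}^d\to\mathbb{R}$ be convex and $L$-smooth on $S$. Let $f^*=\min_{x\in S}f(x)$. Let $\{x^{t,i}\}_{t\ge 0,\,0\le i\le M}$ be a sequence generated by the PolyCD algorithm (see context), and write $x^t:=x^{t,0}$. Then: (1) If the exact line search step sizes are used, i.e. for all $t\ge 0$ and $i\in[M]$ $$\alpha_{t,i}\in\operatorname{argmin}_{\alpha\in[0,1]} f\big(x^{t,i-1}+\alpha(v^i-x^{t,i-1})\big),$$ then for all $t\ge 1$, $$f(x^t)-f^*\le\frac{\max\{f(x^1)-f^*,\;4MLD^2\}}{t}.$$ (2) If the one-dimensional gradient step sizes are used, i.e. for all $t\ge 0$ and $i\in[M]$ $$\alpha_{t,i}\in\operatorname{argmin}_{\alpha\in[0,1]}\Big\{\alpha\langle\nabla f(x^{t,i-1}),v^i-x^{t,i-1}\rangle+\frac{L\alpha^2}{2}\|v^i-x^{t,i-1}\|^2\Big\},$$ then for all $t\ge 1$, $$f(x^t)-f^*\le\frac{\max\{f(x^1)-f^*,\;16MLD^2\}}{t}.$$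
   Context: $\|\cdot\|$ is the Euclidean norm and $[M]=\{1,\dots,M\}$. For a convex set $S$ and $L>0$, $f$ is called $L$-smooth on $S$ if it is differentiable and $\|\nabla f(x)-\nabla f(y)\|\le L\|x-y\|$ for all $x,y\in S$. PolyCD algorithm: start from an arbitrary $x^{0,0}\in S$. For $t=0,1,2,\dots$: for $i=1,2,\dots,M$ in order, set $x^{t,i}=x^{t,i-1}+\alpha_{t,i}(v^i-x^{t,i-1})$, where $\alpha_{t,i}\in[0,1]$ is chosen by the step-size rule; then set $x^{t+1,0}=x^{t,M}$. *)

theory Defs
  imports "HOL-Analysis.Analysis"
begin

definition gradient :: "('a::euclidean_space \<Rightarrow> real) \<Rightarrow> 'a \<Rightarrow> 'a"
  where "gradient f x = (THE g. GDERIV f x :> g)"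

lemma gradient_eqI:
  assumes "GDERIV f x :> g"
  shows "gradient f x = g"
proof -
  have "g' = g" if "GDERIV f x :> g'" for g'
  proof -
    have "(\<lambda>h. h \<bullet> g') = (\<lambda>h. h \<bullet> g)"
      using that assms unfolding gderiv_def by (rule has_derivative_unique)
    then have "\<forall>h. h \<bullet> g' = h \<bullet> g" by metis
    then show ?thesis by (simp add: vector_eq_ldot)
  qed
  with assms show ?thesis unfolding gradient_def by blast
qed

lemma GDERIV_gradient:
  assumes "f differentiable (at x)"
  shows "GDERIV f x :> gradient f x"
proof -
  obtain f' where f': "(f has_derivative f') (at x)"
    using assms unfolding differentiable_def by blast
  have lin: "linear f'" using f' by (rule has_derivative_linear)
  have "f' h = h \<bullet> adjoint f' 1" for h
    using adjoint_works[OF lin, of h 1] by simp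
  then have "f' = (\<lambda>h. h \<bullet> adjoint f' 1)" by blast
  with f' have "GDERIV f x :> adjoint f' 1" unfolding gderiv_def by metis
  moreover from this have "gradient f x = adjoint f' 1" by (rule gradient_eqI)
  ultimately show ?thesis by simp
qed

text \<open>
  Differentiability is in the ambient space, at the points of \<open>S\<close> (which may have empty
  interior); nothing is required of \<open>f\<close> away from \<open>S\<close>.
\<close>

definition smooth_on_with :: "real \<Rightarrow> 'a::euclidean_space set \<Rightarrow> ('a \<Rightarrow> real) \<Rightarrow> bool"
  where "smooth_on_with L S f \<longleftrightarrow>
    (\<forall>x\<in>S. f differentiable (at x)) \<and>
    (\<forall>x\<in>S. \<forall>y\<in>S. norm (gradient f x - gradient f y) \<le> L * norm (x - y))"

text \<open>
  Iterates are \<open>x t i\<close> for \<open>i \<in> {0..M}\<close>, step sizes \<open>\<alpha> t i\<close> and vertices \<open>v i\<close> for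
  \<open>i \<in> {1..M}\<close>; values at other indices are irrelevant.
\<close>

definition polycd ::
  "'a::euclidean_space set \<Rightarrow> nat \<Rightarrow> (nat \<Rightarrow> 'a) \<Rightarrow> (nat \<Rightarrow> nat \<Rightarrow> real) \<Rightarrow> (nat \<Rightarrow> nat \<Rightarrow> 'a) \<Rightarrow> bool"
  where "polycd S M v \<alpha> x \<longleftrightarrow>
    x 0 0 \<in> S \<and>
    (\<forall>t. \<forall>i\<in>{1..M}. \<alpha> t i \<in> {0..1} \<and>
      x t i = x t (i - 1) + \<alpha> t i *\<^sub>R (v i - x t (i - 1))) \<and>
    (\<forall>t. x (Suc t) 0 = x t M)"

definition exact_line_search ::
  "('a::euclidean_space \<Rightarrow> real) \<Rightarrow> nat \<Rightarrow> (nat \<Rightarrow> 'a) \<Rightarrow> (nat \<Rightarrow> nat \<Rightarrow> real) \<Rightarrow> (nat \<Rightarrow> nat \<Rightarrow> 'a) \<Rightarrow> bool"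
  where "exact_line_search f M v \<alpha> x \<longleftrightarrow>
    (\<forall>t. \<forall>i\<in>{1..M}.
      is_arg_min (\<lambda>a. f (x t (i - 1) + a *\<^sub>R (v i - x t (i - 1)))) (\<lambda>a. a \<in> {0..1}) (\<alpha> t i))"

definition gradient_steps ::
  "real \<Rightarrow> ('a::euclidean_space \<Rightarrow> real) \<Rightarrow> nat \<Rightarrow> (nat \<Rightarrow> 'a) \<Rightarrow> (nat \<Rightarrow> nat \<Rightarrow> real) \<Rightarrow> (nat \<Rightarrow> nat \<Rightarrow> 'a) \<Rightarrow> bool"
  where "gradient_steps L f M v \<alpha> x \<longleftrightarrow>
    (\<forall>t. \<forall>i\<in>{1..M}.
      is_arg_min
        (\<lambda>a. a * (gradient f (x t (i - 1)) \<bullet> (v i - x t (i - 1)))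
             + L * a\<^sup>2 / 2 * (norm (v i - x t (i - 1)))\<^sup>2)
        (\<lambda>a. a \<in> {0..1}) (\<alpha> t i))"

end

theory Submission
  imports Defs
begin

text \<open>
  Let \<open>g(x, w) = \<nabla>f(x) \<bullet> (x - w)\<close>; convexity gives \<open>f(x) - f(w) \<le> g(x, w)\<close>.
  Under either rule, an inner step from \<open>z\<close> to \<open>y\<close> towards \<open>v\<^sup>i\<close> which decreases \<open>f\<close> by \<open>\<delta>\<close> satisfies,
  with \<open>e = \<delta> + D sqrt (2 L \<delta>)\<close>, both \<open>g(z, w) \<le> g(y, w) + e\<close> for all \<open>w \<in> S\<close> and
  \<open>g(z, v\<^sup>i) \<le> e\<close>. For gradient steps this holds because \<open>\<delta> \<ge> L \<parallel>y - z\<parallel>\<^sup>2 / 2\<close>. An exact line search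
  may move far along a flat direction, and there a one-sided form of the co-coercivity of \<open>\<nabla>f\<close>,
  valid on \<open>S\<close> alone, replaces the Lipschitz bound.

  Telescoping over one sweep with total decrease \<open>\<Delta>\<close>, and using that \<open>g(x\<^sup>t, \<cdot>)\<close> is affine and
  \<open>S\<close> is the convex hull of the \<open>v\<^sup>i\<close>, gives \<open>f(x\<^sup>t) - f\<^sup>* \<le> \<Delta> + D sqrt (2 M L \<Delta>)\<close>. Hence
  \<open>h\<^sub>t = f(x\<^sup>t) - f\<^sup>*\<close> satisfies \<open>h\<^sub>t\<^sub>+\<^sub>1\<^sup>2 \<le> 2 M L D\<^sup>2 (h\<^sub>t - h\<^sub>t\<^sub>+\<^sub>1)\<close>, which forces the
  rate \<open>1 / t\<close>. The argument gives the constant \<open>4 M L D\<^sup>2\<close> for both rules.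
\<close>

section \<open>First-order optimality on an interval and scalar inequalities\<close>

text \<open>Otherwise a small move from \<open>a\<close> towards \<open>b\<close> would decrease
  \<open>\<psi>\<close>. Leaving \<open>b\<close> free avoids a case split on whether
  \<open>a\<close> is an endpoint; \<open>b = 0\<close> and \<open>b = 1\<close> are the instances
  used later.\<close>

lemma DERIV_min_on_segment:
  fixes \<psi> :: "real \<Rightarrow> real"
  assumes der: "(\<psi> has_real_derivative p) (at a)"
    and ab: "a \<in> {0..1}" "b \<in> {0..1}"
    and min: "\<And>c. c \<in> {0..1} \<Longrightarrow> \<psi> a \<le> \<psi> c"
  shows "p * (b - a) \<ge> 0"
proof (rule ccontr)
  assume neg: "\<not> ?thesis"
  have "((\<lambda>s. \<psi> (a + s * (b - a))) has_real_derivative p * (b - a)) (at 0)"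
    by (rule DERIV_chain2[where g = "\<lambda>s. a + s * (b - a)"])
       (use der in \<open>auto intro!: derivative_eq_intros\<close>)
  from DERIV_neg_dec_right[OF this] neg obtain d where "d > 0"
    and d: "\<And>h. h > 0 \<Longrightarrow> h < d \<Longrightarrow> \<psi> (a + h * (b - a)) < \<psi> a"
    by auto
  define h where "h = min (d / 2) 1"
  have h: "h > 0" "h < d" "h \<le> 1" using \<open>d > 0\<close> by (auto simp: h_def min_def)
  have "(1 - h) *\<^sub>R a + h *\<^sub>R b \<in> {0..1}"
    using ab h by (intro convexD) auto
  then have "a + h * (b - a) \<in> {0..1}" by (simp add: algebra_simps)
  from min[OF this] d[OF h(1,2)] show False by simp
qed

text \<open>Cauchy-Schwarz; it makes the errors of one sweep cost a factor \<open>sqrt M\<close>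
  instead of \<open>M\<close>.\<close>

lemma sum_sqrt_le:
  assumes "\<And>i. i \<in> I \<Longrightarrow> 0 \<le> a i"
  shows "(\<Sum>i\<in>I. sqrt (a i)) \<le> sqrt (real (card I) * (\<Sum>i\<in>I. a i))"
proof (rule real_le_rsqrt)
  have "(\<Sum>i\<in>I. sqrt (a i))\<^sup>2 \<le> (\<Sum>i\<in>I. (sqrt (a i))\<^sup>2) * real (card I)"
    by (rule sum_squared_le_sum_of_squares)
  also have "(\<Sum>i\<in>I. (sqrt (a i))\<^sup>2) = (\<Sum>i\<in>I. a i)"
    using assms by (intro sum.cong) auto
  finally show "(\<Sum>i\<in>I. sqrt (a i))\<^sup>2 \<le> real (card I) * (\<Sum>i\<in>I. a i)"
    by (simp add: mult.commute)
qed

lemma inverse_rate_of_quadratic_recurrence: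
  fixes h :: "nat \<Rightarrow> real"
  assumes "C \<ge> 0" and nonneg: "\<And>t. h t \<ge> 0"
    and rec: "\<And>t. (h (Suc t))\<^sup>2 \<le> C * (h t - h (Suc t))"
    and A: "A \<ge> h 1" "A \<ge> 2 * C" and "t \<ge> 1"
  shows "h t \<le> A / real t"
  using \<open>t \<ge> 1\<close>
proof (induction t rule: dec_induct)
  case base
  then show ?case using A by simp
next
  case (step t)
  define r where "r = real t"
  define k where "k = h (Suc t)"
  have r: "r \<ge> 1" using step by (simp add: r_def)
  have k: "k\<^sup>2 + C * k \<le> C * h t" "k \<ge> 0"
    using rec[of t] nonneg by (auto simp: k_def algebra_simps)
  have "C * (h t * r) \<le> C * A"
    using step.IH r \<open>C \<ge> 0\<close> by (intro mult_left_mono) (auto simp: r_def field_simps)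
  moreover have "(k\<^sup>2 + C * k) * r \<le> C * h t * r"
    using k(1) r by (intro mult_right_mono) auto
  ultimately have *: "(k\<^sup>2 + C * k) * r \<le> C * A" by (simp only: mult.assoc)
  have "k * (r + 1) \<le> A"
  proof (rule ccontr)
    assume "\<not> ?thesis"
    then have big: "k * (r + 1) > A" by simp
    have "A \<ge> 0" using A \<open>C \<ge> 0\<close> by simp
    have "k > 0" using big \<open>A \<ge> 0\<close> k(2) by (cases "k = 0") auto
    \<comment> \<open>Inserted into \<open>*\<close>, this cancels \<open>C * k * r\<close> and
      leaves \<open>k\<^sup>2 * r \<le> C * k\<close>. Then \<open>k \<le> k * r \<le> C\<close>,
      which is where \<open>A \<ge> 2 * C\<close> comes from.\<close>
    have "C * A \<le> C * (k * (r + 1))" using big \<open>C \<ge> 0\<close> by (intro mult_left_mono) auto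
    then have "k * (k * r) \<le> k * C" using * by (simp add: algebra_simps power2_eq_square)
    then have kr: "k * r \<le> C" using \<open>k > 0\<close> by simp
    have "k * 1 \<le> k * r" using r k(2) by (intro mult_left_mono) auto
    then have "k * (r + 1) \<le> 2 * C" using kr by (simp add: algebra_simps)
    then show False using big A by simp
  qed
  then show ?case using r by (simp add: field_simps k_def r_def)
qed

section \<open>Smooth convex functions on a bounded convex set\<close>

locale smooth_convex =
  fixes S :: "'a::euclidean_space set" and f :: "'a \<Rightarrow> real" and L :: real
  assumes convex_S: "convex S" and bounded_S: "bounded S"
    and L_pos: "L > 0" and convex_f: "convex_on S f" and smooth_f: "smooth_on_with L S f"
begin

abbreviation D :: real where "D \<equiv> diameter S"

text \<open>Maximised over \<open>w\<close> in \<open>S\<close>, this is the Frank-Wolfe gap at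
  \<open>x\<close>.\<close>

definition gap :: "'a \<Rightarrow> 'a \<Rightarrow> real"
  where "gap x w = gradient f x \<bullet> (x - w)"

lemma D_nonneg: "D \<ge> 0"
  by (rule diameter_ge_0[OF bounded_S])

lemma norm_le_D: "x \<in> S \<Longrightarrow> y \<in> S \<Longrightarrow> norm (x - y) \<le> D"
  using diameter_bounded_bound[OF bounded_S] by (simp add: dist_norm)

lemma segment_in_S:
  "x \<in> S \<Longrightarrow> y \<in> S \<Longrightarrow> s \<in> {0..1} \<Longrightarrow> x + s *\<^sub>R (y - x) \<in> S"
  using convexD[OF convex_S, of x y "1 - s" s] by (simp add: algebra_simps)

lemma DERIV_along_line:
  assumes "x + s *\<^sub>R w \<in> S"
  shows "((\<lambda>s. f (x + s *\<^sub>R w)) has_real_derivative gradient f (x + s *\<^sub>R w) \<bullet> w) (at s)"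
proof -
  have "f differentiable (at (x + s *\<^sub>R w))"
    using assms smooth_f by (simp add: smooth_on_with_def)
  then have f': "(f has_derivative (\<lambda>h. h \<bullet> gradient f (x + s *\<^sub>R w))) (at (x + s *\<^sub>R w))"
    using GDERIV_gradient unfolding gderiv_def by blast
  have "((\<lambda>s. x + s *\<^sub>R w) has_derivative (\<lambda>h. h *\<^sub>R w)) (at s)"
    by (auto intro!: derivative_eq_intros)
  from has_derivative_compose[OF this f'] show ?thesis
    by (simp add: has_field_derivative_def inner_commute mult_commute_abs)
qed

lemma gradient_lipschitz:
  "x \<in> S \<Longrightarrow> y \<in> S \<Longrightarrow> norm (gradient f x - gradient f y) \<le> L * norm (x - y)"
  using smooth_f by (simp add: smooth_on_with_def)

text \<open>If the tangent slope exceeded the chord slope, \<open>f\<close> minus the chord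
  increment would rise just after \<open>x\<close>, but convexity keeps it at most
  \<open>f x\<close> on the segment.\<close>

lemma gradient_inequality:
  assumes "x \<in> S" "y \<in> S"
  shows "f x + gradient f x \<bullet> (y - x) \<le> f y"
proof (rule ccontr)
  assume neg: "\<not> ?thesis"
  let ?\<psi> = "\<lambda>s. f (x + s *\<^sub>R (y - x)) - s * (f y - f x)"
  have "(?\<psi> has_real_derivative gradient f x \<bullet> (y - x) - (f y - f x)) (at 0)"
    using DERIV_along_line[of x 0 "y - x"] \<open>x \<in> S\<close>
    by (auto intro!: derivative_eq_intros)
  from DERIV_pos_inc_right[OF this] neg obtain d where "d > 0"
    and d: "\<And>h. h > 0 \<Longrightarrow> h < d \<Longrightarrow> f x < ?\<psi> h"
    by auto
  define h where "h = min (d / 2) 1"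
  have h: "h > 0" "h < d" "h \<le> 1" using \<open>d > 0\<close> by (auto simp: h_def min_def)
  have "f ((1 - h) *\<^sub>R x + h *\<^sub>R y) \<le> (1 - h) * f x + h * f y"
    using convex_onD[OF convex_f, of h x y] h assms by simp
  then have "?\<psi> h \<le> f x" by (simp add: algebra_simps)
  with d[OF h(1,2)] show False by simp
qed

text \<open>\<open>f\<close> along the segment minus its quadratic model has nonpositive derivative
  by the Lipschitz bound, so monotonicity replaces integration.\<close>

lemma descent:
  assumes "x \<in> S" "y \<in> S"
  shows "f y \<le> f x + gradient f x \<bullet> (y - x) + L / 2 * (norm (y - x))\<^sup>2"
proof -
  define w where "w = y - x"
  let ?\<psi> = "\<lambda>s. f (x + s *\<^sub>R w) - s * (gradient f x \<bullet> w) - L / 2 * s\<^sup>2 * (norm w)\<^sup>2"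
  have "?\<psi> 1 \<le> ?\<psi> 0"
  proof (rule DERIV_nonpos_imp_nonincreasing[where f = ?\<psi>])
    fix s :: real assume s: "0 \<le> s" "s \<le> 1"
    let ?z = "x + s *\<^sub>R w"
    have z: "?z \<in> S" using segment_in_S[OF assms, of s] s by (simp add: w_def)
    let ?d = "gradient f ?z \<bullet> w - gradient f x \<bullet> w - L * s * (norm w)\<^sup>2"
    have "(?\<psi> has_real_derivative ?d) (at s)"
      using DERIV_along_line[OF z] by (auto intro!: derivative_eq_intros)
    moreover have "?d \<le> 0"
    proof -
      have "(gradient f ?z - gradient f x) \<bullet> w \<le> norm (gradient f ?z - gradient f x) * norm w"
        by (rule norm_cauchy_schwarz)
      also have "\<dots> \<le> L * norm (?z - x) * norm w"
        by (intro mult_right_mono gradient_lipschitz z assms) auto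
      also have "\<dots> = L * s * (norm w)\<^sup>2"
        using s by (simp add: power2_eq_square)
      finally show ?thesis by (simp add: inner_diff_left)
    qed
    ultimately show "\<exists>d. (?\<psi> has_real_derivative d) (at s) \<and> d \<le> 0" by blast
  qed simp
  then show ?thesis by (simp add: w_def)
qed

lemma gap_ge: "x \<in> S \<Longrightarrow> w \<in> S \<Longrightarrow> f x - f w \<le> gap x w"
  using gradient_inequality[of x w] by (simp add: gap_def inner_diff_right)

section \<open>Progress made by a single step\<close>

definition step_error :: "'a \<Rightarrow> 'a \<Rightarrow> real"
  where "step_error z y = (f z - f y) + D * sqrt (2 * L * (f z - f y))"

text \<open>The interface between step-size rules and rate: the bound for all \<open>w\<close>
  transports gaps back through earlier steps, and the bound at \<open>v\<close> starts this chain at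
  the vertex aimed at.\<close>

definition good_step :: "'a \<Rightarrow> 'a \<Rightarrow> 'a \<Rightarrow> bool"
  where "good_step v z y \<longleftrightarrow> f y \<le> f z \<and> (\<forall>w\<in>S. gap z w \<le> gap y w + step_error z y) \<and>
    gap z v \<le> step_error z y"

text \<open>
  One-sided co-coercivity: bound \<open>f\<close> at \<open>z + s (w - z)\<close> from above by descent from \<open>z\<close> and from
  below by the tangent at \<open>y\<close>, then optimise over \<open>s \<in> [0, 1]\<close>. Only directions pointing into \<open>S\<close>
  are tested, so convexity outside \<open>S\<close> plays no role.
\<close>
lemma gap_le_gap_minimizer:
  assumes S: "z \<in> S" "y \<in> S" "w \<in> S" and opt: "gradient f y \<bullet> (z - y) \<ge> 0"
    and le: "f y \<le> f z"
  shows "gap z w \<le> gap y w + step_error z y"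
proof -
  define X where "X = gap z w - gap y w"
  define \<delta> where "\<delta> = f z - f y"
  have "\<delta> \<ge> 0" using le by (simp add: \<delta>_def)
  have D2: "(norm (w - z))\<^sup>2 \<le> D\<^sup>2" by (intro power_mono norm_le_D S) auto
  have key: "s * X \<le> \<delta> + L / 2 * s\<^sup>2 * D\<^sup>2" if s: "s \<in> {0..1}" for s
  proof -
    let ?u = "z + s *\<^sub>R (w - z)"
    have u: "?u \<in> S" by (rule segment_in_S[OF S(1,3) s])
    have "f ?u \<le> f z + gradient f z \<bullet> (?u - z) + L / 2 * (norm (?u - z))\<^sup>2"
      by (rule descent[OF S(1) u])
    moreover have "f y + gradient f y \<bullet> (?u - y) \<le> f ?u"
      by (rule gradient_inequality[OF S(2) u])
    moreover have "gradient f z \<bullet> (?u - z) = - s * gap z w"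
      by (simp add: gap_def inner_diff_right algebra_simps)
    moreover have "gradient f y \<bullet> (?u - y) = (1 - s) * (gradient f y \<bullet> (z - y)) - s * gap y w"
      by (simp add: gap_def inner_diff_right inner_add_right algebra_simps)
    \<comment> \<open>Optimality of \<open>y\<close> lets this term be dropped from the lower
      bound.\<close>
    moreover have "(1 - s) * (gradient f y \<bullet> (z - y)) \<ge> 0"
      using opt s by simp
    moreover have "L / 2 * (norm (?u - z))\<^sup>2 \<le> L / 2 * s\<^sup>2 * D\<^sup>2"
      using D2 L_pos by (simp add: power_mult_distrib mult_left_mono)
    ultimately show ?thesis by (simp add: X_def \<delta>_def algebra_simps)
  qed
  have "X \<le> \<delta> + D * sqrt (2 * L * \<delta>)"
  proof (cases "X \<le> 0")
    case True
    then show ?thesis using \<open>\<delta> \<ge> 0\<close> D_nonneg L_pos by (intro order.trans[OF True]) simp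
  next
    case False
    show ?thesis
    proof (cases "X \<le> L * D\<^sup>2")
      case True
      then have pos: "L * D\<^sup>2 > 0" using False by linarith
      \<comment> \<open>The maximiser of \<open>s * X - L / 2 * s\<^sup>2 * D\<^sup>2\<close>,
        admissible in this case.\<close>
      define s where "s = X / (L * D\<^sup>2)"
      have s: "s \<in> {0..1}" using True False pos by (auto simp: s_def divide_le_eq)
      have X: "X = s * (L * D\<^sup>2)" using pos by (auto simp: s_def)
      have "L / 2 * s\<^sup>2 * D\<^sup>2 = s * X / 2" by (simp add: X power2_eq_square)
      with key[OF s] have "s * X \<le> 2 * \<delta>" by simp
      then have "s * X * (L * D\<^sup>2) \<le> 2 * \<delta> * (L * D\<^sup>2)"
        using pos by (intro mult_right_mono) auto
      also have "s * X * (L * D\<^sup>2) = X\<^sup>2"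
        by (simp add: X power2_eq_square)
      finally have "X\<^sup>2 \<le> 2 * L * \<delta> * D\<^sup>2" by (simp add: mult_ac)
      then have "X \<le> sqrt (2 * L * \<delta> * D\<^sup>2)" by (rule real_le_rsqrt)
      also have "\<dots> = D * sqrt (2 * L * \<delta>)"
        using D_nonneg by (simp add: real_sqrt_mult)
      finally show ?thesis using \<open>\<delta> \<ge> 0\<close> by simp
    next
      case big: False
      \<comment> \<open>The maximiser would exceed 1 (or \<open>D = 0\<close>), so
        \<open>s = 1\<close> is taken. With \<open>X > L * D\<^sup>2\<close> this makes
        \<open>\<delta>\<close> large enough for the square root to absorb
        \<open>L / 2 * D\<^sup>2\<close>.\<close>
      have X: "X \<le> \<delta> + L / 2 * D\<^sup>2" using key[of 1] by simp
      have "L * D\<^sup>2 \<ge> 0" using L_pos by simp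
      have "L / 2 * D \<le> sqrt (2 * L * \<delta>)"
      proof (rule real_le_rsqrt)
        have "L * D\<^sup>2 / 4 \<le> 2 * \<delta>"
          using X big \<open>L * D\<^sup>2 \<ge> 0\<close> by linarith
        from mult_left_mono[OF this, of L] show "(L / 2 * D)\<^sup>2 \<le> 2 * L * \<delta>"
          using L_pos by (simp add: power2_eq_square algebra_simps)
      qed
      from mult_left_mono[OF this D_nonneg] show ?thesis
        using X by (simp add: power2_eq_square algebra_simps)
    qed
  qed
  then show ?thesis by (simp add: X_def \<delta>_def step_error_def)
qed

text \<open>Optimality at \<open>y\<close> towards \<open>z\<close> is the hypothesis of
  \<open>gap_le_gap_minimizer\<close>; towards \<open>v\<close> it gives
  \<open>gap y v \<le> 0\<close>, so taking \<open>w = v\<close> there bounds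
  \<open>gap z v\<close>.\<close>

lemma good_step_exact_line_search:
  assumes S: "z \<in> S" "v \<in> S"
    and min: "is_arg_min (\<lambda>a. f (z + a *\<^sub>R (v - z))) (\<lambda>a. a \<in> {0..1}) a"
    and y: "y = z + a *\<^sub>R (v - z)"
  shows "good_step v z y"
proof -
  have a: "a \<in> {0..1}"
    and le: "\<And>c. c \<in> {0..1} \<Longrightarrow> f (z + a *\<^sub>R (v - z)) \<le> f (z + c *\<^sub>R (v - z))"
    using min unfolding is_arg_min_linorder by auto
  have yS: "y \<in> S" unfolding y by (rule segment_in_S[OF S a])
  have opt: "(gradient f y \<bullet> (v - z)) * (b - a) \<ge> 0" if "b \<in> {0..1}" for b
    using DERIV_min_on_segment[OF DERIV_along_line a that le] yS by (simp add: y)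
  have zy: "z - y = - a *\<^sub>R (v - z)" by (simp add: y)
  have "gradient f y \<bullet> (z - y) = (gradient f y \<bullet> (v - z)) * (0 - a)"
    by (simp add: zy)
  then have 0: "gradient f y \<bullet> (z - y) \<ge> 0" using opt[of 0] by simp
  have "y - v = (a - 1) *\<^sub>R (v - z)"
    unfolding y by (simp add: algebra_simps)
  then have "gap y v = - ((gradient f y \<bullet> (v - z)) * (1 - a))"
    unfolding gap_def by (simp add: left_diff_distrib right_diff_distrib)
  then have 1: "gap y v \<le> 0" using opt[of 1] by simp
  have "f y \<le> f z" using le[of 0] by (simp add: y)
  moreover from this have "gap z w \<le> gap y w + step_error z y" if "w \<in> S" for w
    using gap_le_gap_minimizer[OF S(1) yS that 0] by simp
  ultimately show ?thesis using 1 S(2) unfolding good_step_def by force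
qed

text \<open>The difference of gaps splits into the change of gradient against \<open>z - w\<close>,
  bounded by smoothness, and \<open>gradient f y \<bullet> (z - y)\<close>, bounded by
  convexity.\<close>

lemma gap_le_gap_lipschitz:
  assumes S: "z \<in> S" "y \<in> S" "w \<in> S"
  shows "gap z w \<le> gap y w + (f z - f y) + D * (L * norm (y - z))"
proof -
  have "gap z w - gap y w = (gradient f z - gradient f y) \<bullet> (z - w) + gradient f y \<bullet> (z - y)"
    by (simp add: gap_def inner_diff_left inner_diff_right)
  also have "gradient f y \<bullet> (z - y) \<le> f z - f y"
    using gradient_inequality[OF S(2,1)] by simp
  also have "(gradient f z - gradient f y) \<bullet> (z - w) \<le> norm (gradient f z - gradient f y) * norm (z - w)"
    by (rule norm_cauchy_schwarz)
  also have "\<dots> \<le> L * norm (z - y) * D"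
    by (intro mult_mono gradient_lipschitz norm_le_D S) (use L_pos in auto)
  finally show ?thesis by (simp add: norm_minus_commute algebra_simps)
qed

lemma good_step_gradient:
  assumes S: "z \<in> S" "v \<in> S"
    and min: "is_arg_min (\<lambda>a. a * (gradient f z \<bullet> (v - z)) + L * a\<^sup>2 / 2 * (norm (v - z))\<^sup>2)
      (\<lambda>a. a \<in> {0..1}) a"
    and y: "y = z + a *\<^sub>R (v - z)"
  shows "good_step v z y"
proof -
  define g where "g = gradient f z \<bullet> (v - z)"
  define n where "n = norm (v - z)"
  define \<delta> where "\<delta> = f z - f y"
  let ?\<phi> = "\<lambda>a. a * g + L * a\<^sup>2 / 2 * n\<^sup>2"
  have a: "a \<in> {0..1}"
    and le: "\<And>c. c \<in> {0..1} \<Longrightarrow> ?\<phi> a \<le> ?\<phi> c"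
    using min unfolding is_arg_min_linorder g_def n_def by auto
  have yS: "y \<in> S" unfolding y by (rule segment_in_S[OF S a])
  have ny: "norm (y - z) = a * n" using a by (simp add: y n_def)
  have "(?\<phi> has_real_derivative g + L * a * n\<^sup>2) (at a)"
    by (auto intro!: derivative_eq_intros)
  note opt = DERIV_min_on_segment[OF this a _ le]
  have desc: "\<delta> \<ge> - ?\<phi> a"
    using descent[OF S(1) yS] by (simp add: ny \<delta>_def) (simp add: y g_def power_mult_distrib)
  \<comment> \<open>Optimality towards 0 reads \<open>a * g \<le> - L * (a * n)\<^sup>2\<close>, so
    the model decreases by at least half of that square term.\<close>
  have "L / 2 * (a * n)\<^sup>2 \<le> \<delta>"
    using opt[of 0] desc by (simp add: power2_eq_square algebra_simps)
  then have d2: "(L * (a * n))\<^sup>2 \<le> 2 * L * \<delta>"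
    using mult_left_mono[of "L / 2 * (a * n)\<^sup>2" \<delta> "2 * L"] L_pos
    by (simp add: power2_eq_square algebra_simps)
  then have "0 \<le> 2 * L * \<delta>" by (rule order.trans[OF zero_le_power2])
  then have "\<delta> \<ge> 0" using L_pos by (simp add: zero_le_mult_iff)
  have d: "D * (L * (a * n)) \<le> D * sqrt (2 * L * \<delta>)"
    by (intro mult_left_mono real_le_rsqrt d2 D_nonneg)
  have "0 \<le> L * (a * n)\<^sup>2" using L_pos by simp
  then have "- g \<le> \<delta> + n * (L * (a * n))"
    using opt[of 1] desc by (simp add: power2_eq_square algebra_simps)
  also have "n * (L * (a * n)) \<le> D * (L * (a * n))"
    unfolding n_def by (intro mult_right_mono norm_le_D S) (use L_pos a in auto)
  finally have "gap z v \<le> step_error z y"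
    using d by (simp add: gap_def g_def step_error_def \<delta>_def inner_diff_right)
  moreover have "gap z w \<le> gap y w + step_error z y" if "w \<in> S" for w
    using gap_le_gap_lipschitz[OF S(1) yS that] d by (simp add: ny step_error_def \<delta>_def)
  ultimately show ?thesis using \<open>\<delta> \<ge> 0\<close> by (auto simp: good_step_def \<delta>_def)
qed

section \<open>From one sweep to the rate\<close>

lemma sweep_bound:
  assumes hull: "S \<subseteq> convex hull (v ` {1..M})"
    and y: "\<And>i. i \<le> M \<Longrightarrow> y i \<in> S" and v: "\<And>i. i \<in> {1..M} \<Longrightarrow> v i \<in> S"
    and good: "\<And>i. i \<in> {1..M} \<Longrightarrow> good_step (v i) (y (i - 1)) (y i)"
    and w: "w \<in> S"
  shows "f (y 0) - f w \<le> f (y 0) - f (y M) + D * sqrt (2 * real M * L * (f (y 0) - f (y M)))"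
proof -
  define \<delta> where "\<delta> = (\<lambda>j. f (y (j - 1)) - f (y j))"
  define e where "e = (\<lambda>j. step_error (y (j - 1)) (y j))"
  have e: "e j = \<delta> j + D * sqrt (2 * L * \<delta> j)" for j
    by (simp add: e_def \<delta>_def step_error_def)
  have \<delta>_nonneg: "\<delta> j \<ge> 0" if "j \<in> {1..M}" for j
    using good[OF that] by (simp add: good_step_def \<delta>_def)
  then have e_nonneg: "e j \<ge> 0" if "j \<in> {1..M}" for j
    using that L_pos D_nonneg by (simp add: e)
  have tele: "gap (y 0) u \<le> gap (y k) u + (\<Sum>j=1..k. e j)" if "k \<le> M" "u \<in> S" for k u
    using that(1)
  proof (induction k)
    case (Suc k)
    then show ?case
      using good[of "Suc k"] \<open>u \<in> S\<close> by (force simp: good_step_def e_def)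
  qed simp
  \<comment> \<open>Chain the first \<open>i - 1\<close> steps, then use that step \<open>i\<close>
    aims at \<open>v i\<close>; the remaining errors are nonnegative.\<close>
  have "gap (y 0) (v i) \<le> (\<Sum>j=1..M. e j)" if i: "i \<in> {1..M}" for i
  proof -
    obtain k where k: "i = Suc k" "Suc k \<le> M" using i by (cases i) auto
    have "gap (y k) (v i) \<le> e i"
      using good[OF i] by (simp add: k good_step_def e_def)
    then have "gap (y 0) (v i) \<le> (\<Sum>j=1..i. e j)"
      using tele[of k "v i"] v[OF i] k by simp
    also have "\<dots> \<le> (\<Sum>j=1..M. e j)"
      using i e_nonneg by (intro sum_mono2) auto
    finally show ?thesis .
  qed
  \<comment> \<open>The bound is affine in the vertex, so it defines a halfspace; containing all
    \<open>v i\<close>, it contains their hull and hence \<open>w\<close>.\<close>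
  then have "v ` {1..M} \<subseteq> {u. gradient f (y 0) \<bullet> u \<ge> gradient f (y 0) \<bullet> y 0 - (\<Sum>j=1..M. e j)}"
    by (auto simp: gap_def inner_diff_right algebra_simps)
  from hull_minimal[of _ _ convex, OF this convex_halfspace_ge]
  have "gap (y 0) w \<le> (\<Sum>j=1..M. e j)"
    using hull w by (auto simp: gap_def inner_diff_right algebra_simps)
  moreover have "f (y 0) - f w \<le> gap (y 0) w"
    using gap_ge y w by simp
  moreover have "(\<Sum>j=1..M. e j) = (\<Sum>j=1..M. \<delta> j) + D * (\<Sum>j=1..M. sqrt (2 * L * \<delta> j))"
    by (simp add: e sum.distrib sum_distrib_left)
  moreover have "(\<Sum>j=1..M. \<delta> j) = f (y 0) - f (y M)"
  proof -
    have "(\<Sum>j=1..k. \<delta> j) = f (y 0) - f (y k)" for k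
      by (induction k) (auto simp: \<delta>_def)
    then show ?thesis .
  qed
  moreover have "(\<Sum>j=1..M. sqrt (2 * L * \<delta> j)) \<le> sqrt (2 * real M * L * (\<Sum>j=1..M. \<delta> j))"
    using sum_sqrt_le[of "{1..M}" "\<lambda>j. 2 * L * \<delta> j"] \<delta>_nonneg L_pos
    by (simp add: sum_distrib_left[symmetric] mult.assoc mult.left_commute)
  ultimately show ?thesis
    using mult_left_mono[OF _ D_nonneg] by fastforce
qed

lemma polycd_rate:
  assumes hull: "S \<subseteq> convex hull (v ` {1..M})" and v: "\<And>i. i \<in> {1..M} \<Longrightarrow> v i \<in> S"
    and opt: "w \<in> S" "\<And>y. y \<in> S \<Longrightarrow> f w \<le> f y"
    and cd: "polycd S M v \<alpha> x"
    and good: "\<And>t i. i \<in> {1..M} \<Longrightarrow> x t (i - 1) \<in> S \<Longrightarrow> good_step (v i) (x t (i - 1)) (x t i)"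
    and K: "K \<ge> 4 * real M * L * D\<^sup>2" and "t \<ge> 1"
  shows "f (x t 0) - f w \<le> max (f (x 1 0) - f w) K / real t"
proof -
  have step: "x t i \<in> S" if "i \<in> {1..M}" "x t (i - 1) \<in> S" for t i
    using cd that segment_in_S[OF that(2) v] by (simp add: polycd_def)
  have inner: "x t i \<in> S" if "x t 0 \<in> S" "i \<le> M" for t i
    using that(2)
  proof (induction i)
    case (Suc i)
    then show ?case using step[of "Suc i" t] by simp
  qed (use that in simp)
  have outer: "x t 0 \<in> S" for t
    by (induction t) (use cd inner in \<open>auto simp: polycd_def\<close>)
  have xS: "x t i \<in> S" if "i \<le> M" for t i
    using inner outer that by blast
  define h where "h = (\<lambda>t. f (x t 0) - f w)"
  have nonneg: "h t \<ge> 0" for t using opt(2) outer by (simp add: h_def)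
  have rec: "(h (Suc t))\<^sup>2 \<le> 2 * real M * L * D\<^sup>2 * (h t - h (Suc t))" for t
  proof -
    define \<Delta> where "\<Delta> = f (x t 0) - f (x t M)"
    have \<Delta>: "\<Delta> = h t - h (Suc t)" using cd by (simp add: \<Delta>_def h_def polycd_def)
    have "f (x t i) \<le> f (x t 0)" if "i \<le> M" for i
      using that
    proof (induction i)
      case (Suc i)
      then show ?case using good[of "Suc i" t] xS by (auto simp: good_step_def)
    qed simp
    then have "\<Delta> \<ge> 0" by (simp add: \<Delta>_def)
    have "h t \<le> \<Delta> + D * sqrt (2 * real M * L * \<Delta>)"
      unfolding h_def \<Delta>_def
      by (rule sweep_bound[where y = "x t", OF hull]) (use xS v good opt in auto)
    \<comment> \<open>The linear term \<open>\<Delta> = h t - h (Suc t)\<close> turns the bound on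
      \<open>h t\<close> into one on \<open>h (Suc t)\<close>, ready for squaring.\<close>
    then have "h (Suc t) \<le> D * sqrt (2 * real M * L * \<Delta>)" by (simp add: \<Delta>)
    then have "(h (Suc t))\<^sup>2 \<le> (D * sqrt (2 * real M * L * \<Delta>))\<^sup>2"
      using nonneg by (intro power_mono)
    also have "\<dots> = 2 * real M * L * D\<^sup>2 * \<Delta>"
      using \<open>\<Delta> \<ge> 0\<close> L_pos by (simp add: power_mult_distrib)
    finally show ?thesis by (simp add: \<Delta>)
  qed
  have "h t \<le> max (h 1) K / real t"
    by (rule inverse_rate_of_quadratic_recurrence[where h = h and C = "2 * real M * L * D\<^sup>2"])
       (use K L_pos nonneg rec \<open>t \<ge> 1\<close> in auto)
  then show ?thesis by (simp add: h_def)
qed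

end


theorem theorem2p1:
  fixes S :: "(real ^ 'd) set" and f :: "real ^ 'd \<Rightarrow> real"
    and M :: nat and v :: "nat \<Rightarrow> real ^ 'd"
    and L D fstar :: real
    and \<alpha> :: "nat \<Rightarrow> nat \<Rightarrow> real" and x :: "nat \<Rightarrow> nat \<Rightarrow> real ^ 'd"
  assumes "polytope S"
    and "bij_betw v {1..M} {p. p extreme_point_of S}"
    and "D = diameter S"
    and "L > 0"
    and "convex_on S f"
    and "smooth_on_with L S f"
    and "fstar \<in> f ` S" and "\<forall>y\<in>S. fstar \<le> f y"
    and "polycd S M v \<alpha> x"
  shows "(exact_line_search f M v \<alpha> x \<longrightarrow>
           (\<forall>t\<ge>1. f (x t 0) - fstar \<le> max (f (x 1 0) - fstar) (4 * real M * L * D\<^sup>2) / real t)) \<and>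
         (gradient_steps L f M v \<alpha> x \<longrightarrow>
           (\<forall>t\<ge>1. f (x t 0) - fstar \<le> max (f (x 1 0) - fstar) (16 * real M * L * D\<^sup>2) / real t))"
proof -
  interpret smooth_convex S f L
    using assms by unfold_locales (auto simp: polytope_imp_convex polytope_imp_bounded)
  have ext: "v ` {1..M} = {p. p extreme_point_of S}"
    using assms(2) by (rule bij_betw_imp_surj_on)
  have hull: "S \<subseteq> convex hull (v ` {1..M})"
    unfolding ext using assms(1)
    by (intro equalityD1 Krein_Milman_Minkowski polytope_imp_compact polytope_imp_convex)
  have v: "v i \<in> S" if "i \<in> {1..M}" for i
    using ext that by (auto simp: extreme_point_of_def)
  obtain w where w: "w \<in> S" "fstar = f w" using assms(7) by blast
  have step: "x t i = x t (i - 1) + \<alpha> t i *\<^sub>R (v i - x t (i - 1))" if "i \<in> {1..M}" for t i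
    using assms(9) that by (simp add: polycd_def)
  note rate = polycd_rate[OF hull v w(1) _ assms(9)]
  have "f (x t 0) - fstar \<le> max (f (x 1 0) - fstar) (4 * real M * L * D\<^sup>2) / real t"
    if "exact_line_search f M v \<alpha> x" "t \<ge> 1" for t
    unfolding w(2) assms(3)
    by (rule rate)
       (use that assms(8) w in \<open>auto intro!: good_step_exact_line_search v step
          simp: exact_line_search_def simp del: One_nat_def\<close>)
  \<comment> \<open>\<open>polycd_rate\<close> allows any \<open>K\<close> above
    \<open>4 * M * L * D\<^sup>2\<close>; here \<open>K\<close> is four times that.\<close>
  moreover have "f (x t 0) - fstar \<le> max (f (x 1 0) - fstar) (16 * real M * L * D\<^sup>2) / real t"
    if "gradient_steps L f M v \<alpha> x" "t \<ge> 1" for t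
    unfolding w(2) assms(3)
    by (rule rate)
       (use that assms(8) w L_pos in \<open>auto intro!: good_step_gradient v step
          simp: gradient_steps_def simp del: One_nat_def\<close>)
  ultimately show ?thesis by blast
qed

end
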